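(* Let $A\in\mathbb{R}^{k_1\times k_2}$, $b_1\in\mathbb{R}^{k_1}$, $b_2\in\mathbb{R}^{k_2}$, and suppose the unconstrained bilinear zero-sum game defined by $(A,b_1,b_2)$ admits a Nash equilibrium $x^\star\in\mathbb{R}^{k_1+k_2}$. Let $\eta>0$ be arbitrary and let $\{x^t\}_{t\ge 0}$ be generated by Implicit Midpoint Gradient Descent (IMGD) with learning rate $\eta$ from an arbitrary initial point $x^0\in\mathbb{R}^{k_1+k_2}$. Then for every such Nash equilibrium $x^\star$ and all $t\ge 0$, $$\lVert x^{t+1}-x^\star\rVert=\lVert x^{t}-x^\star\rVert .$$
   Context: The game: player 1 chooses $x_1\in\mathbb{R}^{k_1}$ and player 2 chooses $x_2\in\mathbb{R}^{k_2}$, with utilities $u_1(x_1,x_2)=x_1^\top A x_2+b_1^\top x_1-b_2^\top x_2$ and $u_2=-u_1$. A pair $x^\star=(x_1^\star,x_2^\star)$ is a Nash equilibrium if $u_1(x_1,x_2^\star)\le u_1(x_1^\star,x_2^\star)\le u_1(x_1^\star,x_2)$ for all $x_1\in\mathbb{R}^{k_1}$, $x_2\in\mathbb{R}^{k_2}$; equivalently $Gx^\star+c=0$, where $$G=\begin{pmatrix} 0 & A \\ -A^\top & 0 \end{pmatrix},\qquad c=\begin{pmatrix} b_1 \\ b_2 \end{pmatrix}.$$ Stack $x=(x_1,x_2)\in\mathbb{R}^{k_1+k_2}$. IMGD with learning rate $\eta>0$ is the iteration $$x^{t+1}=x^t+\tfrac{\eta}{2}\bigl((Gx^{t+1}+c)+(Gx^t+c)\bigr),$$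 i.e. $x^{t+1}=(I-\tfrac{\eta}{2}G)^{-1}\bigl((I+\tfrac{\eta}{2}G)x^t+\eta c\bigr)$ (the inverse exists for every $\eta>0$). $\lVert\cdot\rVert$ is the Euclidean norm. *)

theory Defs
  imports "HOL-Analysis.Analysis"
begin

text \<open>Points of \<open>\<real>\<^bsup>k\<^sub>1 + k\<^sub>2\<^esup>\<close> are vectors over the sum index type \<open>'m + 'n\<close>, where
  \<open>CARD('m)\<close> is \<open>k\<^sub>1\<close> and \<open>CARD('n)\<close> is \<open>k\<^sub>2\<close>; the left summand indexes player 1's coordinates.\<close>

definition stack :: "real ^ 'm \<Rightarrow> real ^ 'n \<Rightarrow> real ^ ('m::finite + 'n::finite)" where
  "stack x1 x2 = (\<chi> i. case i of Inl a \<Rightarrow> x1 $ a | Inr b \<Rightarrow> x2 $ b)"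

definition part1 :: "real ^ ('m::finite + 'n::finite) \<Rightarrow> real ^ 'm" where
  "part1 x = (\<chi> a. x $ Inl a)"

definition part2 :: "real ^ ('m::finite + 'n::finite) \<Rightarrow> real ^ 'n" where
  "part2 x = (\<chi> b. x $ Inr b)"

definition utility1 ::
    "real ^ 'n ^ 'm \<Rightarrow> real ^ 'm \<Rightarrow> real ^ 'n \<Rightarrow> real ^ 'm \<Rightarrow> real ^ 'n \<Rightarrow> real" where
  "utility1 A b1 b2 x1 x2 = x1 \<bullet> (A *v x2) + b1 \<bullet> x1 - b2 \<bullet> x2"

text \<open>Player 2's utility is \<open>- utility1 A b1 b2\<close>, so player 2 minimises \<open>utility1\<close>.\<close>

definition nash_equilibrium ::
    "real ^ 'n ^ 'm \<Rightarrow> real ^ 'm \<Rightarrow> real ^ 'n \<Rightarrow> real ^ ('m::finite + 'n::finite) \<Rightarrow> bool" where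
  "nash_equilibrium A b1 b2 x \<longleftrightarrow>
     (\<forall>x1. utility1 A b1 b2 x1 (part2 x) \<le> utility1 A b1 b2 (part1 x) (part2 x)) \<and>
     (\<forall>x2. utility1 A b1 b2 (part1 x) (part2 x) \<le> utility1 A b1 b2 (part1 x) x2)"

definition game_matrix :: "real ^ 'n ^ 'm \<Rightarrow> real ^ ('m::finite + 'n::finite) ^ ('m + 'n)" where
  "game_matrix A = (\<chi> i j. case (i, j) of
      (Inl a, Inl a') \<Rightarrow> 0
    | (Inl a, Inr b) \<Rightarrow> A $ a $ b
    | (Inr b, Inl a) \<Rightarrow> - transpose A $ b $ a
    | (Inr b, Inr b') \<Rightarrow> 0)"

definition imgd ::
    "real ^ 'n ^ 'm \<Rightarrow> real ^ 'm \<Rightarrow> real ^ 'n \<Rightarrow> real \<Rightarrow>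
       (nat \<Rightarrow> real ^ ('m::finite + 'n::finite)) \<Rightarrow> bool" where
  "imgd A b1 b2 \<eta> x \<longleftrightarrow>
     (\<forall>t. x (Suc t) = x t + (\<eta> / 2) *\<^sub>R
        ((game_matrix A *v x (Suc t) + stack b1 b2) + (game_matrix A *v x t + stack b1 b2)))"

end

theory Submission
  imports Defs
begin

text \<open>At a Nash equilibrium both partial gradients of the utility vanish, so \<open>G x\<^sup>\<star> + c = 0\<close> and the
  errors \<open>d\<^sub>t = x\<^sub>t - x\<^sup>\<star>\<close> satisfy \<open>d\<^sub>t\<^sub>+\<^sub>1 - d\<^sub>t = (\<eta>/2) G (d\<^sub>t\<^sub>+\<^sub>1 + d\<^sub>t)\<close>. Since \<open>G\<close> is skew-symmetric,
  pairing with \<open>d\<^sub>t\<^sub>+\<^sub>1 + d\<^sub>t\<close> gives \<open>\<parallel>d\<^sub>t\<^sub>+\<^sub>1\<parallel>\<^sup>2 - \<parallel>d\<^sub>t\<parallel>\<^sup>2 = 0\<close>.\<close>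

text \<open>A scalar equals its own transpose, so skewness makes this one equal to its
  negative.\<close>

lemma inner_skew_matrix_vector_mult:
  fixes M :: "real ^ 'k ^ 'k"
  assumes "transpose M = - M"
  shows "v \<bullet> (M *v v) = 0"
proof -
  have "v \<bullet> (M *v v) = (transpose M *v v) \<bullet> v"
    by (simp flip: dot_lmul_matrix)
  also have "\<dots> = - (v \<bullet> (M *v v))"
    \<comment> \<open>The instance with \<open>0\<close> supplies
      \<open>(- M) *v v = - (M *v v)\<close>.\<close>
    using matrix_vector_mult_diff_rdistrib[of 0 M v] by (simp add: assms inner_commute)
  finally show ?thesis by simp
qed

lemma transpose_game_matrix: "transpose (game_matrix A) = - game_matrix A"
  by (simp add: vec_eq_iff transpose_def game_matrix_def split: sum.split)

lemma game_matrix_mult: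
  "game_matrix A *v x = stack (A *v part2 x) (- (part1 x v* A))"
proof -
  have "(game_matrix A *v x) $ i = stack (A *v part2 x) (- (part1 x v* A)) $ i" for i
    by (cases i)
      (simp_all add: matrix_vector_mult_def vector_matrix_mult_def game_matrix_def stack_def
        part1_def part2_def transpose_def sum.Plus sum_negf mult.commute flip: UNIV_Plus_UNIV)
  then show ?thesis by (simp add: vec_eq_iff)
qed

text \<open>The utility is affine in each player's own strategy, so a deviation by the gradient
  \<open>g\<close> itself gains exactly \<open>g \<bullet> g\<close>, which equilibrium forces to be
  at most 0.\<close>

lemma nash_equilibrium_first_order:
  assumes "nash_equilibrium A b1 b2 x"
  shows "A *v part2 x + b1 = 0" and "b2 - part1 x v* A = 0"
proof -
  let ?g1 = "A *v part2 x + b1" and ?g2 = "b2 - part1 x v* A"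
  have "utility1 A b1 b2 (part1 x + ?g1) (part2 x) \<le> utility1 A b1 b2 (part1 x) (part2 x)"
    using assms by (auto simp: nash_equilibrium_def)
  then have "?g1 \<bullet> ?g1 \<le> 0"
    by (simp add: utility1_def inner_add_left inner_add_right inner_commute)
  then show "?g1 = 0" by (metis inner_eq_zero_iff inner_ge_zero order_antisym)
  \<comment> \<open>Player 2 minimises, so \<open>?g2\<close> is the negative gradient in
    \<open>x2\<close>.\<close>
  have "utility1 A b1 b2 (part1 x) (part2 x) \<le> utility1 A b1 b2 (part1 x) (part2 x + ?g2)"
    using assms by (auto simp: nash_equilibrium_def)
  then have "?g2 \<bullet> ?g2 \<le> 0"
    by (simp add: utility1_def inner_add_right inner_diff_left flip: dot_lmul_matrix)
  then show "?g2 = 0" by (metis inner_eq_zero_iff inner_ge_zero order_antisym)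
qed

lemma nash_equilibrium_stationary:
  assumes "nash_equilibrium A b1 b2 x"
  shows "game_matrix A *v x + stack b1 b2 = 0"
proof -
  have "A *v part2 x = - b1" and "part1 x v* A = b2"
    using nash_equilibrium_first_order[OF assms] by (simp_all add: eq_neg_iff_add_eq_0)
  then show ?thesis
    by (simp add: game_matrix_mult stack_def vec_eq_iff split: sum.split)
qed

theorem theorem1:
  fixes A :: "real ^ 'n ^ 'm" and b1 :: "real ^ 'm" and b2 :: "real ^ 'n"
    and \<eta> :: real and x :: "nat \<Rightarrow> real ^ ('m::finite + 'n::finite)" and xstar :: "real ^ ('m::finite + 'n::finite)"
  assumes "nash_equilibrium A b1 b2 xstar"
    and "\<eta> > 0"
    and "imgd A b1 b2 \<eta> x"
  shows "\<forall>t. norm (x (t + 1) - xstar) = norm (x t - xstar)"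
proof
  fix t
  let ?G = "game_matrix A :: real ^ ('m + 'n) ^ ('m + 'n)" and ?c = "stack b1 b2"
  let ?d = "x t - xstar" and ?d' = "x (t + 1) - xstar"
  \<comment> \<open>Subtracting the stationarity equation absorbs the constant
    \<open>?c\<close>.\<close>
  have error: "?G *v y + ?c = ?G *v (y - xstar)" for y
    using nash_equilibrium_stationary[OF assms(1)]
    by (simp add: matrix_vector_mult_diff_distrib add_eq_0_iff)
  have "x (t + 1) = x t + (\<eta> / 2) *\<^sub>R ((?G *v x (t + 1) + ?c) + (?G *v x t + ?c))"
    using assms(3) by (simp add: imgd_def)
  \<comment> \<open>Using the gradient at both endpoints makes \<open>?G\<close> act on
    \<open>?d' + ?d\<close>, the very vector paired with the increment below.\<close>
  then have "x (t + 1) = x t + (\<eta> / 2) *\<^sub>R (?G *v (?d' + ?d))"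
    by (simp only: error matrix_vector_right_distrib)
  then have "?d' - ?d = (\<eta> / 2) *\<^sub>R (?G *v (?d' + ?d))"
    by (simp only: diff_diff_eq2 diff_add_cancel diff_eq_eq add.commute[of _ "x t"])
  then have "(?d' + ?d) \<bullet> (?d' - ?d) = 0"
    by (simp only: inner_scaleR_right inner_skew_matrix_vector_mult[OF transpose_game_matrix] mult_zero_right)
  moreover have "(u + v) \<bullet> (u - v) = u \<bullet> u - v \<bullet> v" for u v :: "real ^ ('m + 'n)"
    by (simp add: inner_add_left inner_diff_right inner_commute[of v u])
  ultimately have "?d' \<bullet> ?d' = ?d \<bullet> ?d"
    by (metis eq_iff_diff_eq_0)
  then show "norm ?d' = norm ?d" by (simp only: norm_eq)
qed

end
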